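(* Let $0<\sigma<1$ and $u>0$ be fixed, and let $t_s=t_s(u)$ be the unique root in $(1,\infty)$ of $$t^{-\sigma}(t-1)=\frac{1}{\sigma u}.$$ Then, as $k\to+\infty$ through the positive integers and with $x=ku$, $${}_1\Psi_1(-\sigma,k;-\sigma,0;-x)=\Gamma(k)\sqrt{\frac{k}{2\pi(1-\sigma)}}\left(t_s+\frac{\sigma}{1-\sigma}\right)^{-1/2}\exp\left[k\,\psi(t_s)\right]\left\{1+O(k^{-1})\right\},$$ where $$\psi(t_s)=-\log(1-\tau_s)-\frac{\tau_s}{\sigma(1-\tau_s)},\qquad \tau_s=\frac{1}{t_s}.$$
   Context: For a positive integer $k$, real $\rho\ne0$ and real $z$, ${}_1\Psi_1(\rho,k;\rho,0;z)=\sum_{n=0}^\infty \frac{\Gamma(k+\rho n)}{\Gamma(\rho n)}\frac{z^n}{n!}$, where the quotient $\Gamma(k+\rho n)/\Gamma(\rho n)$ is understood (by a limit where necessary) as $\prod_{j=0}^{k-1}(\rho n+j)$. *)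

theory Defs
  imports "HOL-Analysis.Analysis" "HOL-Library.Landau_Symbols"
begin

text \<open>
  The function \<open>\<^sub>1\<Psi>\<^sub>1(\<rho>, k; \<rho>, 0; z)\<close>.  The quotient \<open>\<Gamma>(k + \<rho> n) / \<Gamma>(\<rho> n)\<close> is read as its
  limiting value \<open>\<Prod>j<k. \<rho> n + j\<close>, which is the Pochhammer symbol (cf. \<open>pochhammer_Gamma\<close>);
  in particular it vanishes at \<open>n = 0\<close> when \<open>k > 0\<close>.
\<close>

definition Psi11 :: "real \<Rightarrow> nat \<Rightarrow> real \<Rightarrow> real" where
  "Psi11 \<rho> k z = (\<Sum>n. pochhammer (\<rho> * real n) k * z ^ n / fact n)"

lemma summable_Psi11:
  fixes \<rho> z :: real
  shows "summable (\<lambda>n. pochhammer (\<rho> * real n) k * z ^ n / fact n)"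
proof (rule summable_comparison_test)
  define C where "C = \<bar>\<rho>\<bar> + real k"
  define D where "D = C ^ k * (fact k * exp 1)"
  have C: "C \<ge> 0" by (simp add: C_def)
  have bnd: "norm (pochhammer (\<rho> * real n) k * z ^ n / fact n)
      \<le> D * (inverse (fact n) * (exp 1 * \<bar>z\<bar>) ^ n)" for n
  proof -
    have "\<bar>pochhammer (\<rho> * real n) k\<bar> = (\<Prod>j\<in>{0..<k}. \<bar>\<rho> * real n + real j\<bar>)"
      by (simp add: pochhammer_prod abs_prod)
    also have "\<dots> \<le> (\<Prod>j\<in>{0..<k}. C * (real n + 1))"
    proof (rule prod_mono, intro conjI)
      fix j assume "j \<in> {0..<k}"
      hence j: "real j \<le> real k" by simp
      have "\<bar>\<rho> * real n + real j\<bar> \<le> \<bar>\<rho>\<bar> * real n + real j"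
        by (rule order_trans[OF abs_triangle_ineq]) (simp add: abs_mult)
      also have "\<dots> \<le> \<bar>\<rho>\<bar> * real n + real k + \<bar>\<rho>\<bar> + real k * real n"
        using j by (simp add: add_increasing2)
      finally show "\<bar>\<rho> * real n + real j\<bar> \<le> C * (real n + 1)"
        by (simp add: C_def algebra_simps)
    qed simp
    also have "\<dots> = C ^ k * (real n + 1) ^ k" by (simp add: power_mult_distrib)
    also have "\<dots> \<le> C ^ k * (fact k * exp (real n + 1))"
    proof (rule mult_left_mono)
      have "(real n + 1) ^ k / fact k \<le> exp (real n + 1)"
      proof -
        have s: "(\<lambda>m. (real n + 1) ^ m / fact m) sums exp (real n + 1)"
          using exp_converges[of "real n + 1"] by (simp add: divide_inverse mult.commute)
        have "(\<Sum>m\<in>{k}. (real n + 1) ^ m / fact m) \<le> (\<Sum>m. (real n + 1) ^ m / fact m)"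
          by (rule sum_le_suminf) (use s in \<open>auto simp: sums_iff\<close>)
        thus ?thesis using s by (simp add: sums_iff)
      qed
      thus "(real n + 1) ^ k \<le> fact k * exp (real n + 1)"
        by (simp add: field_simps)
    qed (use C in simp)
    also have "\<dots> = D * exp 1 ^ n"
      by (simp add: D_def exp_add mult_ac flip: exp_of_nat_mult)
    finally have *: "\<bar>pochhammer (\<rho> * real n) k\<bar> \<le> D * exp 1 ^ n" .
    have "norm (pochhammer (\<rho> * real n) k * z ^ n / fact n)
        = \<bar>pochhammer (\<rho> * real n) k\<bar> * (\<bar>z\<bar> ^ n / fact n)"
      by (simp add: abs_mult power_abs)
    also have "\<dots> \<le> (D * exp 1 ^ n) * (\<bar>z\<bar> ^ n / fact n)"
      by (rule mult_right_mono[OF *]) simp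
    finally show ?thesis by (simp add: power_mult_distrib field_simps)
  qed
  show "\<exists>N. \<forall>n\<ge>N. norm (pochhammer (\<rho> * real n) k * z ^ n / fact n)
      \<le> D * (inverse (fact n) * (exp 1 * \<bar>z\<bar>) ^ n)"
    using bnd by blast
  show "summable (\<lambda>n. D * (inverse (fact n) * (exp 1 * \<bar>z\<bar>) ^ n))"
    by (intro summable_mult summable_exp)
qed

definition is_saddle :: "real \<Rightarrow> real \<Rightarrow> real \<Rightarrow> bool" where
  "is_saddle \<sigma> u t \<longleftrightarrow> t > 1 \<and> t powr (-\<sigma>) * (t - 1) = 1 / (\<sigma> * u)"

definition t_saddle :: "real \<Rightarrow> real \<Rightarrow> real" where
  "t_saddle \<sigma> u = (THE t. is_saddle \<sigma> u t)"

definition psi_saddle :: "real \<Rightarrow> real \<Rightarrow> real" where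
  "psi_saddle \<sigma> t = (let \<tau> = 1 / t in - ln (1 - \<tau>) - \<tau> / (\<sigma> * (1 - \<tau>)))"

end

theory Submission
  imports Defs "HOL-Probability.Distributions" "HOL-Real_Asymp.Real_Asymp"
begin

text \<open>
  Since \<open>pochhammer (- \<sigma> n) k / k!\<close> is the coefficient of \<open>w\<^sup>k\<close> in \<open>(1 - w)\<close> raised to \<open>\<sigma> n\<close>,
  \<open>Psi11 (- \<sigma>) k (- x) / k!\<close> is the coefficient of \<open>w\<^sup>k\<close> in \<open>exp (- x S(w))\<close> with
  \<open>S(w) = (1 - w) powr \<sigma>\<close>, hence a Fourier integral over a circle of radius \<open>r < 1\<close>.
  For \<open>x = k u\<close> the saddle point of the integrand is \<open>r = 1 - 1 / t\<^sub>s\<close>.  As \<open>0 < \<sigma> < 1\<close>,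
  \<open>S(w) = 1 - (\<Sum>n\<ge>1. b\<^sub>n w\<^sup>n)\<close> with all \<open>b\<^sub>n \<ge> 0\<close>; so on the whole circle the real and imaginary
  parts of the exponent are cosine and sine series with nonnegative coefficients.  The
  termwise Taylor bounds for \<open>sin\<close> and \<open>cos\<close> then give a Gaussian majorant on all of
  \<open>[-\<pi>, \<pi>]\<close>, and only the real part of the integrand matters, in which the cubic term of
  the exponent enters quadratically; this yields the relative error \<open>O(1/k)\<close>.
\<close>

section \<open>Coefficient extraction on a circle\<close>

text \<open>The Weierstrass M-test makes the partial sums converge uniformly, and uniform limits
  commute with integration over a compact interval.\<close>

lemma sums_integral_uniform:
  fixes f :: "nat \<Rightarrow> real \<Rightarrow> 'a::banach"
  assumes cont: "\<And>n. continuous_on {a..b} (f n)"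
    and sums: "\<And>x. x \<in> {a..b} \<Longrightarrow> (\<lambda>n. f n x) sums g x"
    and bound: "\<And>n x. x \<in> {a..b} \<Longrightarrow> norm (f n x) \<le> M n"
    and "summable M"
  shows "(\<lambda>n. integral {a..b} (f n)) sums integral {a..b} g"
proof -
  have "uniform_limit {a..b} (\<lambda>n x. \<Sum>i<n. f i x) (\<lambda>x. \<Sum>i. f i x) sequentially"
    using bound \<open>summable M\<close> by (rule Weierstrass_m_test)
  then have ul: "uniform_limit {a..b} (\<lambda>n x. \<Sum>i<n. f i x) g sequentially"
    using sums by (subst uniform_limit_cong'[where g = "\<lambda>n x. \<Sum>i<n. f i x" and i = "\<lambda>x. \<Sum>i. f i x"])
      (auto simp: sums_iff)
  obtain I J where I: "\<And>n. ((\<lambda>x. \<Sum>i<n. f i x) has_integral I n) {a..b}"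
    and J: "(g has_integral J) {a..b}" and lim: "I \<longlonglongrightarrow> J"
    using uniform_limit_integral[OF ul] cont by (auto intro!: continuous_intros)
  have "I = (\<lambda>n. \<Sum>i<n. integral {a..b} (f i))"
  proof
    fix n
    show "I n = (\<Sum>i<n. integral {a..b} (f i))"
      using I[of n] cont by (subst integral_sum[symmetric])
        (auto simp: integral_unique integrable_continuous_real)
  qed
  with lim J show ?thesis
    by (simp add: sums_def integral_unique)
qed

lemma integral_cis_of_int:
  "integral {-pi..pi} (\<lambda>\<theta>. cis (of_int m * \<theta>)) = (if m = 0 then 2 * of_real pi else 0)"
proof (cases "m = 0")
  case True
  then show ?thesis by (simp add: scaleR_conv_of_real)
next
  case False
  have "((\<lambda>\<theta>. cis (of_int m * \<theta>)) has_integral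
      cis (of_int m * pi) / (\<i> * of_int m) - cis (of_int m * (-pi)) / (\<i> * of_int m)) {-pi..pi}"
  proof (intro fundamental_theorem_of_calculus)
    fix x assume "x \<in> {-pi..pi}"
    have "((\<lambda>z. exp (\<i> * of_int m * z) / (\<i> * of_int m)) has_field_derivative
        exp (\<i> * of_int m * of_real x)) (at (of_real x))"
      using False by (auto intro!: derivative_eq_intros)
    from has_vector_derivative_real_field[OF this, of "{-pi..pi}"]
    show "((\<lambda>\<theta>. cis (of_int m * \<theta>) / (\<i> * of_int m)) has_vector_derivative
        cis (of_int m * x)) (at x within {-pi..pi})"
      by (simp add: cis_conv_exp mult.assoc)
  qed auto
  \<comment> \<open>The primitive takes equal values at both ends, since the two sides differ by
    \<open>2 * \<i> * sin (m * pi) = 0\<close>.\<close>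
  moreover have "cis (of_int m * pi) = cis (of_int m * (-pi))"
    by (auto simp: complex_eq_iff sin_zero_iff_int2)
  ultimately show ?thesis using False by (simp add: integral_unique)
qed

section \<open>Binomial series and their coefficients as circle integrals\<close>

lemma one_minus_powr_sums:
  fixes w a :: complex
  assumes "norm w < 1"
  shows "(\<lambda>n. pochhammer (- a) n / fact n * w ^ n) sums ((1 - w) powr a)"
proof -
  have "(\<lambda>n. (a gchoose n) * (- w) ^ n) sums ((1 + - w) powr a)"
    by (rule gen_binomial_complex) (use assms in simp)
  \<comment> \<open>The sign \<open>(-1) ^ n\<close> relating binomial coefficients to Pochhammer
    symbols cancels the sign of \<open>- w\<close>.\<close>
  moreover have "(a gchoose n) * (- w) ^ n = pochhammer (- a) n / fact n * w ^ n" for n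
    by (cases "even n") (auto simp: gbinomial_pochhammer)
  ultimately show ?thesis by simp
qed

lemma pochhammer_powser_sums:
  fixes r a :: real
  assumes "\<bar>r\<bar> < 1"
  shows "(\<lambda>n. pochhammer a n / fact n * r ^ n) sums ((1 - r) powr (- a))"
proof -
  have "(\<lambda>n. (- a gchoose n) * (- r) ^ n) sums (1 + - r) powr (- a)"
    by (rule gen_binomial_real) (use assms in simp)
  moreover have "(- a gchoose n) * (- r) ^ n = pochhammer a n / fact n * r ^ n" for n
    by (cases "even n") (auto simp: gbinomial_pochhammer)
  ultimately show ?thesis by simp
qed

text \<open>Factor by factor \<open>\<bar>a + j\<bar> \<le> \<bar>a\<bar> + j\<close>, so the
  binomial series with parameter \<open>\<bar>a\<bar>\<close> is a convergent majorant.\<close>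

lemma pochhammer_powser_summable:
  fixes a r :: real
  assumes "0 \<le> r" "r < 1"
  shows "summable (\<lambda>n. \<bar>pochhammer a n / fact n\<bar> * r ^ n)"
proof (rule summable_comparison_test)
  show "\<exists>N. \<forall>n\<ge>N. norm (\<bar>pochhammer a n / fact n\<bar> * r ^ n) \<le> pochhammer \<bar>a\<bar> n / fact n * r ^ n"
  proof (intro exI allI impI)
    fix n
    have "\<bar>pochhammer a n\<bar> \<le> pochhammer \<bar>a\<bar> n"
      unfolding pochhammer_prod abs_prod by (intro prod_mono) auto
    then show "norm (\<bar>pochhammer a n / fact n\<bar> * r ^ n) \<le> pochhammer \<bar>a\<bar> n / fact n * r ^ n"
      using assms by (auto simp: abs_mult intro!: mult_right_mono divide_right_mono)
  qed
  show "summable (\<lambda>n. pochhammer \<bar>a\<bar> n / fact n * r ^ n)"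
    using pochhammer_powser_sums[of r "\<bar>a\<bar>"] assms by (simp add: sums_iff)
qed

lemma one_minus_rcis_nonzero:
  assumes "0 \<le> r" "r < 1"
  shows "1 - rcis r \<theta> \<noteq> 0"
proof
  assume "1 - rcis r \<theta> = 0"
  then have "norm (rcis r \<theta>) = 1" by (simp flip: eq_iff_diff_eq_0)
  with assms show False by simp
qed

text \<open>For \<open>r < 1\<close> the points \<open>1 - rcis r \<theta>\<close> have positive
  real part and so avoid the branch cut of the principal power.\<close>

lemma continuous_on_one_minus_rcis_powr:
  fixes r \<sigma> :: real
  assumes "0 < r" "r < 1"
  shows "continuous_on A (\<lambda>\<theta>. (1 - rcis r \<theta>) powr (of_real \<sigma>))"
proof -
  have "r * cos \<theta> < 1" for \<theta>
    using mult_left_mono[OF cos_le_one, of r \<theta>] assms by linarith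
  then have "r * cos \<theta> \<le> 1" "r * cos \<theta> \<noteq> 1" for \<theta>
    by (simp_all add: less_imp_le less_imp_neq)
  then show ?thesis unfolding rcis_def
    by (intro continuous_intros) (auto simp: complex_nonpos_Reals_iff complex_eq_iff)
qed

text \<open>Integrating the binomial series term by term leaves only the term \<open>n = k\<close>,
  by orthogonality of the characters. Frequencies are integers because \<open>n - k\<close> may be
  negative.\<close>

lemma integral_one_minus_powr_circle:
  fixes r a :: real
  assumes "0 \<le> r" "r < 1"
  shows "integral {-pi..pi} (\<lambda>\<theta>. (1 - rcis r \<theta>) powr (of_real a) * cis (- (real k * \<theta>)))
    = 2 * of_real pi * of_real (pochhammer (- a) k / fact k * r ^ k)"
proof -
  let ?c = "\<lambda>n. pochhammer (- a) n / fact n * r ^ n"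
  let ?f = "\<lambda>n \<theta>. complex_of_real (?c n) * cis (of_int (int n - int k) * \<theta>)"
  have "(\<lambda>n. ?f n \<theta>) sums ((1 - rcis r \<theta>) powr (of_real a) * cis (- (real k * \<theta>)))" for \<theta>
  proof -
    have "(\<lambda>n. pochhammer (- of_real a) n / fact n * rcis r \<theta> ^ n * cis (- (real k * \<theta>)))
        sums ((1 - rcis r \<theta>) powr (of_real a) * cis (- (real k * \<theta>)))"
      using assms by (intro sums_mult2 one_minus_powr_sums) auto
    moreover have "pochhammer (- of_real a) n / fact n * rcis r \<theta> ^ n * cis (- (real k * \<theta>)) = ?f n \<theta>" for n
    proof -
      have "cis (real n * \<theta>) * cis (- (real k * \<theta>)) = cis (of_int (int n - int k) * \<theta>)"
        by (simp add: cis_mult algebra_simps)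
      moreover have "rcis r \<theta> ^ n = of_real (r ^ n) * cis (real n * \<theta>)"
        unfolding rcis_def power_mult_distrib Complex.DeMoivre by simp
      ultimately show ?thesis
        using pochhammer_of_real[of "-a" n, where 'a = complex] by (simp add: mult.assoc)
    qed
    ultimately show ?thesis by simp
  qed
  moreover have "norm (?f n \<theta>) \<le> \<bar>pochhammer (- a) n / fact n\<bar> * r ^ n" for n \<theta>
    using assms by (simp add: norm_mult power_abs norm_divide norm_power)
  ultimately have "(\<lambda>n. integral {-pi..pi} (?f n)) sums
      integral {-pi..pi} (\<lambda>\<theta>. (1 - rcis r \<theta>) powr (of_real a) * cis (- (real k * \<theta>)))"
    using pochhammer_powser_summable[OF assms]
    by (intro sums_integral_uniform) (auto intro!: continuous_intros)
  moreover have "integral {-pi..pi} (?f n) = (if n = k then 2 * of_real pi * of_real (?c k) else 0)" for n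
    by (subst integral_mult_right) (use integral_cis_of_int[of "int n - int k"] in simp)
  ultimately have "(\<lambda>n. if n = k then 2 * of_real pi * of_real (?c k) else 0) sums
      integral {-pi..pi} (\<lambda>\<theta>. (1 - rcis r \<theta>) powr (of_real a) * cis (- (real k * \<theta>)))"
    by simp
  moreover have "(\<lambda>n. if n = k then 2 * of_real pi * complex_of_real (?c k) else 0) sums
      (2 * of_real pi * of_real (?c k))"
    by (rule sums_single)
  ultimately show ?thesis by (rule sums_unique2)
qed

lemma norm_one_minus_rcis_powr_le:
  assumes "0 \<le> r" "r < 1" "0 \<le> a"
  shows "norm ((1 - rcis r \<theta>) powr (of_real a)) \<le> 2 powr a"
proof -
  have "norm (1 - rcis r \<theta>) \<le> 2" using norm_triangle_ineq4[of 1 "rcis r \<theta>"] assms by simp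
  then show ?thesis using one_minus_rcis_nonzero[of r \<theta>] assms
    by (simp add: norm_powr_real_powr' powr_mono2)
qed

text \<open>Expand the exponential in powers of \<open>S = (1 - w) powr \<sigma>\<close>. Since
  \<open>S ^ n\<close> is \<open>(1 - w)\<close> raised to \<open>\<sigma> * n\<close>, its
  \<open>k\<close>-th coefficient is \<open>pochhammer (- \<sigma> * n) k / fact k\<close>, and the
  defining series of \<open>Psi11\<close> reappears term by term.\<close>

lemma Psi11_conv_integral:
  fixes r \<sigma> x :: real
  assumes r: "0 < r" "r < 1" and "0 \<le> \<sigma>"
  shows "of_real (Psi11 (- \<sigma>) k (- x)) = of_real (fact k / (2 * pi * r ^ k)) *
    integral {-pi..pi} (\<lambda>\<theta>. exp (- of_real x * (1 - rcis r \<theta>) powr (of_real \<sigma>)) * cis (- (real k * \<theta>)))"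
proof -
  let ?S = "\<lambda>\<theta>. (1 - rcis r \<theta>) powr (of_real \<sigma>)"
  let ?f = "\<lambda>n \<theta>. ((- of_real x * ?S \<theta>) ^ n /\<^sub>R fact n) * cis (- (real k * \<theta>))"
  have eq: "?f n \<theta> = of_real ((- x) ^ n / fact n) *
      ((1 - rcis r \<theta>) powr (of_real (\<sigma> * real n)) * cis (- (real k * \<theta>)))" for n \<theta>
  proof -
    have "?S \<theta> ^ n = (1 - rcis r \<theta>) powr (of_real (\<sigma> * real n))"
      using one_minus_rcis_nonzero[of r \<theta>] r by (simp add: powr_def mult_ac flip: exp_of_nat_mult)
    then show ?thesis by (simp only: power_mult_distrib) (simp add: scaleR_conv_of_real divide_inverse mult_ac)
  qed
  have bnd: "norm (?f n \<theta>) \<le> (\<bar>x\<bar> * 2 powr \<sigma>) ^ n /\<^sub>R fact n" for n \<theta>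
    using norm_one_minus_rcis_powr_le[of r \<sigma> \<theta>] assms
    by (auto simp: norm_mult norm_power norm_divide power_mult_distrib intro!: mult_left_mono power_mono)
  have "(\<lambda>n. integral {-pi..pi} (?f n)) sums integral {-pi..pi} (\<lambda>\<theta>. exp (- of_real x * ?S \<theta>) * cis (- (real k * \<theta>)))"
  proof (rule sums_integral_uniform)
    show "continuous_on {-pi..pi} (?f n)" for n
      using r by (intro continuous_intros continuous_on_one_minus_rcis_powr)
    show "(\<lambda>n. ?f n \<theta>) sums (exp (- of_real x * ?S \<theta>) * cis (- (real k * \<theta>)))" for \<theta>
      by (intro sums_mult2 exp_converges)
    show "summable (\<lambda>n. (\<bar>x\<bar> * 2 powr \<sigma>) ^ n /\<^sub>R fact n)" by (rule summable_exp_generic)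
  qed (rule bnd)
  moreover have "integral {-pi..pi} (?f n) =
     of_real (pochhammer (- \<sigma> * real n) k * (- x) ^ n / fact n * (2 * pi * r ^ k / fact k))" for n
    unfolding eq
    by (subst integral_mult_right, subst integral_one_minus_powr_circle) (use r in auto)
  ultimately have "(\<lambda>n. complex_of_real (pochhammer (- \<sigma> * real n) k * (- x) ^ n / fact n * (2 * pi * r ^ k / fact k)))
     sums integral {-pi..pi} (\<lambda>\<theta>. exp (- of_real x * ?S \<theta>) * cis (- (real k * \<theta>)))" by simp
  moreover have "(\<lambda>n. complex_of_real (pochhammer (- \<sigma> * real n) k * (- x) ^ n / fact n * (2 * pi * r ^ k / fact k)))
     sums of_real (Psi11 (- \<sigma>) k (- x) * (2 * pi * r ^ k / fact k))"
    unfolding Psi11_def by (intro sums_of_real sums_mult2 summable_sums summable_Psi11)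
  ultimately have "of_real (Psi11 (- \<sigma>) k (- x) * (2 * pi * r ^ k / fact k)) =
     integral {-pi..pi} (\<lambda>\<theta>. exp (- of_real x * ?S \<theta>) * cis (- (real k * \<theta>)))"
    by (rule sums_unique2[rotated])
  from this[symmetric] show ?thesis
    using r by (simp only: flip: of_real_mult) (simp add: field_simps)
qed

section \<open>A Laplace estimate with relative error of order \<open>1/k\<close>\<close>

lemma has_integral_gaussian:
  fixes a :: real
  assumes "a > 0"
  shows "((\<lambda>x. exp (- a * x\<^sup>2)) has_integral sqrt (pi / a)) UNIV"
proof -
  \<comment> \<open>The Gaussian is a multiple of the centred normal density of variance
    \<open>1 / (2 * a)\<close>, whose integral is 1.\<close>
  define s where "s = sqrt (1 / (2 * a))"
  have s: "s > 0" "s\<^sup>2 = 1 / (2 * a)" using assms by (simp_all add: s_def)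
  have "((\<lambda>x. sqrt (pi / a) * normal_density 0 s x) has_integral sqrt (pi / a) * 1) UNIV"
    using has_integral_integral_lborel[OF integrable_normal_density[OF s(1), of 0]] s(1)
    by (intro has_integral_mult_right) simp
  moreover have "sqrt (pi / a) * normal_density 0 s x = exp (- a * x\<^sup>2)" for x
    using assms by (simp add: normal_density_def s real_sqrt_divide mult_ac)
  ultimately show ?thesis by simp
qed

text \<open>A single term of the exponential series of \<open>d * y\<close> is at most the whole
  sum. This trades powers of \<open>y\<close> for a small loss in exponential decay.\<close>

lemma power_le_fact_exp:
  fixes y d :: real
  assumes "y \<ge> 0" "d > 0"
  shows "y ^ m \<le> fact m / d ^ m * exp (d * y)"
proof -
  have "(\<Sum>i\<in>{m}. (d * y) ^ i /\<^sub>R fact i) \<le> (\<Sum>i. (d * y) ^ i /\<^sub>R fact i)"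
    using assms summable_exp_generic[of "d * y"] by (intro sum_le_suminf) auto
  then have "(d * y) ^ m / fact m \<le> exp (d * y)"
    by (simp add: exp_def divide_inverse mult.commute)
  then show ?thesis
    using assms by (simp add: field_simps power_mult_distrib)
qed

lemma one_minus_cos_bound: "\<bar>1 - cos y - y\<^sup>2 / 2\<bar> \<le> y ^ 4 / 24" for y :: real
proof -
  obtain t where "cos y = (\<Sum>m<4. cos_coeff m * y ^ m) + (cos (t + 1/2 * real 4 * pi) / fact 4) * y ^ 4"
    using Maclaurin_cos_expansion[of y 4] by blast
  then have "cos y = 1 - y\<^sup>2 / 2 + cos (t + 2 * pi) / 24 * y ^ 4"
    by (simp add: cos_coeff_def lessThan_nat_numeral lessThan_Suc fact_numeral)
  then have "\<bar>1 - cos y - y\<^sup>2 / 2\<bar> = \<bar>cos t\<bar> * (y ^ 4 / 24)"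
    by (simp add: abs_mult)
  also have "\<dots> \<le> 1 * (y ^ 4 / 24)" by (intro mult_right_mono) auto
  finally show ?thesis by simp
qed

lemma one_minus_cos_le: "1 - cos y \<le> y\<^sup>2 / 2" for y :: real
proof -
  have "1 - cos y = 2 * (sin (y / 2))\<^sup>2"
    using cos_double_sin[of "y / 2"] by simp
  also have "(sin (y / 2))\<^sup>2 \<le> (y / 2)\<^sup>2"
    by (rule abs_le_square_iff[THEN iffD1, OF abs_sin_x_le_abs_x])
  finally show ?thesis by (simp add: power2_eq_square)
qed

lemma sin_minus_self_bound: "\<bar>sin y - y\<bar> \<le> \<bar>y\<bar> ^ 3 / 6" for y :: real
  using Maclaurin_sin_bound[of y 3] by (simp add: sin_coeff_def numeral_eq_Suc fact_numeral)

text \<open>The fourth-order bound gives \<open>1 - cos y \<ge> y\<^sup>2 / 2 - y ^ 4 / 24\<close>.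
  On the interval \<open>y\<^sup>2 \<le> 10.8\<close>, and
  \<open>1/2 - 10.8/24 = 1/20\<close>.\<close>

lemma one_minus_cos_ge:
  fixes y :: real
  assumes "\<bar>y\<bar> \<le> pi"
  shows "1 - cos y \<ge> y\<^sup>2 / 20"
proof -
  have "pi\<^sup>2 \<le> 3.2\<^sup>2" using pi_approx by (intro power_mono) auto
  moreover have "y\<^sup>2 \<le> pi\<^sup>2" using assms by (metis abs_le_square_iff abs_of_pos pi_gt_zero)
  ultimately have "y\<^sup>2 \<le> 10.8" by (simp add: power2_eq_square)
  then have "y\<^sup>2 * y\<^sup>2 \<le> 10.8 * y\<^sup>2" by (intro mult_right_mono) auto
  then have "y ^ 4 \<le> 10.8 * y\<^sup>2" by (simp flip: power_add)
  then show ?thesis using one_minus_cos_bound[of y] by linarith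
qed

lemma exp_diff_bound:
  fixes x y m :: real
  assumes "x \<le> m" "y \<le> m"
  shows "\<bar>exp x - exp y\<bar> \<le> \<bar>x - y\<bar> * exp m"
proof -
  have *: "exp b - exp a \<le> (b - a) * exp m" if "a \<le> b" "b \<le> m" for a b :: real
  proof -
    have "exp b - exp a = exp b * (1 - exp (a - b))" by (simp add: exp_diff right_diff_distrib)
    also have "\<dots> \<le> exp b * (b - a)"
    proof (rule mult_left_mono)
      show "1 - exp (a - b) \<le> b - a" using exp_ge_add_one_self[of "a - b"] by linarith
    qed auto
    also have "\<dots> \<le> exp m * (b - a)" using that by (intro mult_right_mono) auto
    finally show ?thesis by (simp add: mult.commute)
  qed
  show ?thesis using *[of x y] *[of y x] assms by (cases "x \<le> y") auto
qed

text \<open>Extend the integrand by zero and compare it pointwise with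
  \<open>exp (- k * A / 2 * \<theta>\<^sup>2)\<close>. In terms of
  \<open>y = k * \<theta>\<^sup>2\<close> the difference is at most \<open>1 / k\<close> times a
  polynomial in \<open>y\<close> times \<open>exp (- b * y)\<close>. Integrating over the Gaussian
  width of order \<open>1 / sqrt k\<close> then gives the error
  \<open>1 / (k * sqrt k)\<close>.\<close>

lemma laplace_asymptotic_real_part:
  fixes P Q :: "real \<Rightarrow> real"
  assumes L: "L > 0" and A: "A > 0" and c: "c > 0"
    and cont: "continuous_on {-L..L} P" "continuous_on {-L..L} Q"
    and P: "\<And>\<theta>. \<bar>\<theta>\<bar> \<le> L \<Longrightarrow> \<bar>P \<theta> + A / 2 * \<theta>\<^sup>2\<bar> \<le> C * \<theta> ^ 4"
    and Q: "\<And>\<theta>. \<bar>\<theta>\<bar> \<le> L \<Longrightarrow> \<bar>Q \<theta>\<bar> \<le> D * \<bar>\<theta>\<bar> ^ 3"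
    and Pneg: "\<And>\<theta>. \<bar>\<theta>\<bar> \<le> L \<Longrightarrow> P \<theta> \<le> - c * \<theta>\<^sup>2"
  shows "\<exists>M. \<forall>k>0. \<bar>integral {-L..L} (\<lambda>\<theta>. exp (k * P \<theta>) * cos (k * Q \<theta>)) - sqrt (2 * pi / (k * A))\<bar>
    \<le> M / (k * sqrt k)"
proof -
  \<comment> \<open>A decay rate valid for both the integrand and the comparison Gaussian.\<close>
  define b where "b = min c (A / 2)"
  have b: "b > 0" "b \<le> c" "b \<le> A / 2" using c A by (auto simp: b_def)
  \<comment> \<open>The sign of \<open>C\<close> follows from the bound on \<open>P\<close> at the
    endpoint \<open>L\<close>.\<close>
  have "C * L ^ 4 \<ge> 0" using P[of L] L by (intro order_trans[OF abs_ge_zero]) auto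
  then have C: "C \<ge> 0" using L by (simp add: zero_le_mult_iff)
  \<comment> \<open>The three summands pay for the quartic error of \<open>P\<close>, the squared
    phase \<open>Q\<close>, and the tail outside \<open>[-L, L]\<close>. Each factorial quotient
    comes from \<open>power_le_fact_exp\<close> with \<open>d = b / 2\<close>.\<close>
  define M where "M = C * (fact 2 / (b/2)^2) + D\<^sup>2 / 2 * (fact 3 / (b/2)^3) + 1 / L\<^sup>2 * (fact 1 / (b/2)^1)"
  have M_bound: "C * y ^ 2 + D\<^sup>2 / 2 * y ^ 3 + 1 / L\<^sup>2 * y ^ 1 \<le> M * exp (b / 2 * y)" if "y \<ge> 0" for y
    unfolding M_def distrib_right mult.assoc
    using that C b(1) by (intro add_mono mult_left_mono power_le_fact_exp) auto
  have "\<bar>integral {-L..L} (\<lambda>\<theta>. exp (k * P \<theta>) * cos (k * Q \<theta>)) - sqrt (2 * pi / (k * A))\<bar>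
      \<le> (M * sqrt (2 * pi / b)) / (k * sqrt k)" if k: "k > 0" for k
  proof -
    let ?G = "\<lambda>\<theta>. if \<theta> \<in> {-L..L} then exp (k * P \<theta>) * cos (k * Q \<theta>) else 0"
    let ?E = "\<lambda>\<theta>. exp (- (k * A / 2) * \<theta>\<^sup>2)"
    let ?B = "\<lambda>\<theta>. M / k * exp (- (k * b / 2) * \<theta>\<^sup>2)"
    let ?I = "integral {-L..L} (\<lambda>\<theta>. exp (k * P \<theta>) * cos (k * Q \<theta>))"
    have "((\<lambda>\<theta>. exp (k * P \<theta>) * cos (k * Q \<theta>)) has_integral ?I) {-L..L}"
      using cont by (intro integrable_integral integrable_continuous_real continuous_intros)
    then have G: "(?G has_integral ?I) UNIV"
      by (subst has_integral_restrict_UNIV)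
    have E: "(?E has_integral sqrt (pi / (k * A / 2))) UNIV"
      using k A by (intro has_integral_gaussian) auto
    have B: "(?B has_integral M / k * sqrt (pi / (k * b / 2))) UNIV"
      using k b by (intro has_integral_mult_right has_integral_gaussian) auto
    have pw: "\<bar>?G \<theta> - ?E \<theta>\<bar> \<le> ?B \<theta>" for \<theta>
    proof -
      define y where "y = k * \<theta>\<^sup>2"
      have y: "y \<ge> 0" using k by (simp add: y_def)
      have "\<bar>?G \<theta> - ?E \<theta>\<bar> \<le> (C * y ^ 2 + D\<^sup>2 / 2 * y ^ 3 + 1 / L\<^sup>2 * y ^ 1) / k * exp (- b * y)"
      proof (cases "\<bar>\<theta>\<bar> \<le> L")
        case True
        have ky: "k * P \<theta> \<le> - b * y" "- (k * A / 2) * \<theta>\<^sup>2 \<le> - b * y"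
        proof -
          have "k * P \<theta> \<le> k * (- c * \<theta>\<^sup>2)" using k Pneg[OF True] by (intro mult_left_mono) auto
          also have "\<dots> = - c * y" by (simp add: y_def)
          also have "\<dots> \<le> - b * y" using b y by (intro mult_right_mono) auto
          finally show "k * P \<theta> \<le> - b * y" .
          have "- (A / 2) * y \<le> - b * y" using b y by (intro mult_right_mono) auto
          then show "- (k * A / 2) * \<theta>\<^sup>2 \<le> - b * y" by (simp add: y_def algebra_simps)
        qed
        have "\<bar>exp (k * P \<theta>) - ?E \<theta>\<bar> \<le> \<bar>k * P \<theta> - - (k * A / 2) * \<theta>\<^sup>2\<bar> * exp (- b * y)"
          using ky by (rule exp_diff_bound)
        also have "k * P \<theta> - - (k * A / 2) * \<theta>\<^sup>2 = k * (P \<theta> + A / 2 * \<theta>\<^sup>2)"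
          by (simp add: algebra_simps)
        also have "\<bar>\<dots>\<bar> \<le> k * (C * \<theta> ^ 4)"
          using P[OF True] k by (simp add: abs_mult)
        also have "k * (C * \<theta> ^ 4) = C * y ^ 2 / k"
          using k by (simp add: y_def field_simps eval_nat_numeral)
        finally have 1: "\<bar>exp (k * P \<theta>) - ?E \<theta>\<bar> \<le> C * y ^ 2 / k * exp (- b * y)"
          by (simp add: mult_right_mono)
        have "\<bar>exp (k * P \<theta>) * (cos (k * Q \<theta>) - 1)\<bar> = exp (k * P \<theta>) * (1 - cos (k * Q \<theta>))"
          by (simp add: abs_mult)
        also have "\<dots> \<le> exp (- b * y) * ((k * Q \<theta>)\<^sup>2 / 2)"
          using ky one_minus_cos_le[of "k * Q \<theta>"] by (intro mult_mono) auto
        \<comment> \<open>The cosine turns the cubic phase into its square, and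
          \<open>k\<^sup>2 * \<theta> ^ 6 = y ^ 3 / k\<close> supplies the required factor
          \<open>1 / k\<close>.\<close>
        also have "(k * Q \<theta>)\<^sup>2 \<le> (k * (D * \<bar>\<theta>\<bar> ^ 3))\<^sup>2"
          using Q[OF True] k by (intro power2_le_iff_abs_le[THEN iffD2]) (auto simp: abs_mult)
        also have "\<dots> = D\<^sup>2 * y ^ 3 / k"
          using k by (simp add: y_def power_mult_distrib field_simps power2_eq_square power3_eq_cube)
        finally have 2: "\<bar>exp (k * P \<theta>) * (cos (k * Q \<theta>) - 1)\<bar> \<le> D\<^sup>2 / 2 * y ^ 3 / k * exp (- b * y)"
          by (simp add: mult_ac)
        have 3: "0 \<le> 1 / L\<^sup>2 * y ^ 1 / k * exp (- b * y)" using y k by simp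
        have "?G \<theta> - ?E \<theta> = (exp (k * P \<theta>) - ?E \<theta>) + exp (k * P \<theta>) * (cos (k * Q \<theta>) - 1)"
          using True by (simp add: algebra_simps abs_le_iff)
        then have "\<bar>?G \<theta> - ?E \<theta>\<bar> \<le> \<bar>exp (k * P \<theta>) - ?E \<theta>\<bar> + \<bar>exp (k * P \<theta>) * (cos (k * Q \<theta>) - 1)\<bar>"
          by linarith
        then show ?thesis using 1 2 3 by (simp add: add_divide_distrib distrib_right)
      next
        case False
        \<comment> \<open>Outside \<open>[-L, L]\<close> we have \<open>1 \<le> y / (L\<^sup>2 k)\<close>, so the Gaussian tail is absorbed in the same bound.\<close>
        then have "L\<^sup>2 \<le> \<theta>\<^sup>2" using L by (intro abs_le_square_iff[THEN iffD1]) auto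
        then have y1: "1 \<le> 1 / L\<^sup>2 * y ^ 1 / k" using L k by (simp add: y_def)
        have "(A / 2) * y \<ge> b * y" using b y by (intro mult_right_mono) auto
        then have "?E \<theta> \<le> exp (- b * y)" by (simp add: y_def algebra_simps)
        also have "\<dots> \<le> 1 / L\<^sup>2 * y ^ 1 / k * exp (- b * y)" using y1 mult_right_mono[OF y1, of "exp (- b * y)"] by simp
        also have "\<dots> \<le> (C * y ^ 2 + D\<^sup>2 / 2 * y ^ 3 + 1 / L\<^sup>2 * y ^ 1) / k * exp (- b * y)"
          using y k C by (intro mult_right_mono divide_right_mono) auto
        finally have "\<bar>- ?E \<theta>\<bar> \<le> (C * y ^ 2 + D\<^sup>2 / 2 * y ^ 3 + 1 / L\<^sup>2 * y ^ 1) / k * exp (- b * y)"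
          by simp
        moreover have "?G \<theta> - ?E \<theta> = - ?E \<theta>" using False by auto
        ultimately show ?thesis by simp
      qed
      \<comment> \<open>Half of the decay absorbs the polynomial; the other half remains as an
        integrable Gaussian.\<close>
      also have "\<dots> \<le> M * exp (b / 2 * y) / k * exp (- b * y)"
        using M_bound[OF y] k by (intro mult_right_mono divide_right_mono) auto
      also have "\<dots> = M / k * (exp (b / 2 * y) * exp (- b * y))" by simp
      also have "exp (b / 2 * y) * exp (- b * y) = exp (- (k * b / 2) * \<theta>\<^sup>2)"
        by (simp add: y_def field_simps flip: exp_add)
      finally show ?thesis .
    qed
    have "norm (integral UNIV (\<lambda>\<theta>. ?G \<theta> - ?E \<theta>)) \<le> integral UNIV ?B"
      using G E B pw by (intro integral_norm_bound_integral) (auto intro!: integrable_diff simp: has_integral_integrable)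
    moreover have "integral UNIV (\<lambda>\<theta>. ?G \<theta> - ?E \<theta>) = ?I - sqrt (pi / (k * A / 2))"
      by (rule integral_unique[OF has_integral_diff[OF G E]])
    ultimately have "\<bar>?I - sqrt (pi / (k * A / 2))\<bar> \<le> M / k * sqrt (pi / (k * b / 2))"
      unfolding integral_unique[OF B] real_norm_def by simp
    then show ?thesis
      by (simp add: real_sqrt_divide real_sqrt_mult mult_ac)
  qed
  then show ?thesis by blast
qed

section \<open>Trigonometric series with nonnegative coefficients\<close>

lemma pochhammer_Suc_over_fact_Suc:
  fixes a :: real
  shows "real (Suc n) * (pochhammer a (Suc n) / fact (Suc n)) = a * (pochhammer (a + 1) n / fact n)"
  by (simp add: pochhammer_rec del: of_nat_Suc)

text \<open>Weighting by \<open>n\<close> amounts to applying \<open>r * d/dr\<close>: it shifts the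
  index by one and raises the parameter \<open>a\<close> to \<open>a + 1\<close>. The term
  \<open>n = 0\<close> vanishes, so the shifted series has the full sum.\<close>

lemma pochhammer_powser_moment1:
  fixes r a :: real
  assumes "\<bar>r\<bar> < 1"
  shows "(\<lambda>n. real n * (pochhammer a n / fact n * r ^ n)) sums (a * r * (1 - r) powr (- (a + 1)))"
proof -
  have "(\<lambda>n. a * r * (pochhammer (a + 1) n / fact n * r ^ n)) sums (a * r * (1 - r) powr (- (a + 1)))"
    using assms by (intro sums_mult pochhammer_powser_sums)
  also have "(\<lambda>n. a * r * (pochhammer (a + 1) n / fact n * r ^ n))
      = (\<lambda>n. real (Suc n) * (pochhammer a (Suc n) / fact (Suc n) * r ^ Suc n))"
    using pochhammer_Suc_over_fact_Suc[of _ a] by (simp only: mult.assoc[symmetric]) (simp add: mult_ac)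
  finally show ?thesis by (subst (asm) sums_Suc_iff) (simp add: add.assoc)
qed

text \<open>One factor of \<open>(n + 1)\<^sup>2\<close> is absorbed by the index shift; the other
  splits into the first moment and the plain sum for the parameter \<open>a + 1\<close>.\<close>

lemma pochhammer_powser_moment2:
  fixes r a :: real
  assumes "\<bar>r\<bar> < 1"
  shows "(\<lambda>n. (real n)\<^sup>2 * (pochhammer a n / fact n * r ^ n)) sums
    (a * r * ((a + 1) * r * (1 - r) powr (- (a + 2)) + (1 - r) powr (- (a + 1))))"
proof -
  let ?p = "\<lambda>n. pochhammer (a + 1) n / fact n * r ^ n"
  have "(\<lambda>n. a * r * (real n * ?p n + ?p n)) sums
      (a * r * ((a + 1) * r * (1 - r) powr (- (a + 1 + 1)) + (1 - r) powr (- (a + 1))))"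
    using assms by (intro sums_mult sums_add pochhammer_powser_sums pochhammer_powser_moment1)
  also have "(\<lambda>n. a * r * (real n * ?p n + ?p n))
      = (\<lambda>n. (real (Suc n))\<^sup>2 * (pochhammer a (Suc n) / fact (Suc n) * r ^ Suc n))"
  proof
    fix n
    have "(real (Suc n))\<^sup>2 * (pochhammer a (Suc n) / fact (Suc n) * r ^ Suc n)
        = real (Suc n) * (real (Suc n) * (pochhammer a (Suc n) / fact (Suc n))) * r ^ Suc n"
      by (simp only: power2_eq_square mult_ac)
    then show "a * r * (real n * ?p n + ?p n)
        = (real (Suc n))\<^sup>2 * (pochhammer a (Suc n) / fact (Suc n) * r ^ Suc n)"
      unfolding pochhammer_Suc_over_fact_Suc by (simp add: field_simps)
  qed
  finally show ?thesis by (subst (asm) sums_Suc_iff) (simp add: add.assoc)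
qed

text \<open>Passing to the smaller radius gains the factor \<open>(r / s) ^ n\<close>, which beats
  any power of \<open>n\<close>.\<close>

lemma summable_power_times_powser:
  fixes f :: "nat \<Rightarrow> real"
  assumes "summable (\<lambda>n. \<bar>f n\<bar> * s ^ n)" "0 \<le> r" "r < s"
  shows "summable (\<lambda>n. real n ^ m * (\<bar>f n\<bar> * r ^ n))"
proof (rule summable_comparison_test_ev[OF _ assms(1)])
  define q where "q = r / s"
  have q: "0 \<le> q" "q < 1" and r: "r = q * s" using assms by (auto simp: q_def)
  have "(\<lambda>n. real n ^ m * q ^ n) \<longlonglongrightarrow> 0"
  proof (cases "q = 0")
    case True
    then show ?thesis
      by (intro tendsto_eventually eventually_mono[OF eventually_gt_at_top[of 0]]) auto
  next
    case False
    then show ?thesis using q by real_asymp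
  qed
  then have "eventually (\<lambda>n. real n ^ m * q ^ n < 1) sequentially"
    by (rule order_tendstoD) simp
  then show "eventually (\<lambda>n. norm (real n ^ m * (\<bar>f n\<bar> * r ^ n)) \<le> \<bar>f n\<bar> * s ^ n) sequentially"
  proof eventually_elim
    case (elim n)
    have "(real n ^ m * q ^ n) * (\<bar>f n\<bar> * s ^ n) \<le> 1 * (\<bar>f n\<bar> * s ^ n)"
      using elim assms by (intro mult_right_mono) auto
    then show ?case using assms q by (simp add: abs_mult r power_mult_distrib mult_ac)
  qed
qed

text \<open>The pointwise cosine bounds are summed with nonnegative weights. For the lower bound
  only the term \<open>n = 1\<close> is kept, which already gives quadratic growth on all of
  \<open>[-\<pi>, \<pi>]\<close>. The sign condition excludes \<open>n = 0\<close>, whose term is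
  zero in every series.\<close>

lemma cos_series_bounds:
  fixes c :: "nat \<Rightarrow> real"
  assumes c: "\<And>n. n > 0 \<Longrightarrow> c n \<ge> 0"
    and s2: "(\<lambda>n. (real n)\<^sup>2 * c n) sums A"
    and s4: "(\<lambda>n. real n ^ 4 * c n) sums B"
    and P: "(\<lambda>n. c n * (1 - cos (real n * \<theta>))) sums P"
  shows "\<bar>P - A / 2 * \<theta>\<^sup>2\<bar> \<le> B / 24 * \<theta> ^ 4"
    and "\<bar>\<theta>\<bar> \<le> pi \<Longrightarrow> c 1 / 20 * \<theta>\<^sup>2 \<le> P"
proof -
  have d: "(\<lambda>n. c n * (1 - cos (real n * \<theta>)) - (real n)\<^sup>2 * c n * (\<theta>\<^sup>2 / 2)) sums (P - A * (\<theta>\<^sup>2 / 2))"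
    by (intro sums_diff sums_mult2 P s2)
  have e: "(\<lambda>n. real n ^ 4 * c n * (\<theta> ^ 4 / 24)) sums (B * (\<theta> ^ 4 / 24))"
    by (intro sums_mult2 s4)
  have "norm (c n * (1 - cos (real n * \<theta>)) - (real n)\<^sup>2 * c n * (\<theta>\<^sup>2 / 2)) \<le> real n ^ 4 * c n * (\<theta> ^ 4 / 24)" for n
  proof (cases "n = 0")
    case False
    have "c n * (1 - cos (real n * \<theta>)) - (real n)\<^sup>2 * c n * (\<theta>\<^sup>2 / 2)
        = c n * (1 - cos (real n * \<theta>) - (real n * \<theta>)\<^sup>2 / 2)"
      by (simp add: algebra_simps power_mult_distrib)
    also have "norm \<dots> \<le> c n * ((real n * \<theta>) ^ 4 / 24)"
      using mult_left_mono[OF one_minus_cos_bound, of "c n" "real n * \<theta>"] c[of n] False by (simp add: abs_mult)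
    finally show ?thesis by (simp add: power_mult_distrib mult_ac)
  qed auto
  then have "norm (suminf (\<lambda>n. c n * (1 - cos (real n * \<theta>)) - (real n)\<^sup>2 * c n * (\<theta>\<^sup>2 / 2)))
      \<le> suminf (\<lambda>n. real n ^ 4 * c n * (\<theta> ^ 4 / 24))"
    by (intro norm_suminf_le) (use e in \<open>auto simp: sums_iff\<close>)
  then show "\<bar>P - A / 2 * \<theta>\<^sup>2\<bar> \<le> B / 24 * \<theta> ^ 4"
    using d e by (simp add: sums_iff)
next
  assume \<theta>: "\<bar>\<theta>\<bar> \<le> pi"
  have nn: "c n * (1 - cos (real n * \<theta>)) \<ge> 0" for n
    using c[of n] by (cases "n = 0") auto
  have "c 1 / 20 * \<theta>\<^sup>2 \<le> c 1 * (1 - cos \<theta>)"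
    using c[of 1] one_minus_cos_ge[OF \<theta>] mult_left_mono[of "\<theta>\<^sup>2 / 20" "1 - cos \<theta>" "c 1"] by simp
  also have "\<dots> = (\<Sum>n\<in>{1}. c n * (1 - cos (real n * \<theta>)))" by simp
  also have "\<dots> \<le> (\<Sum>n. c n * (1 - cos (real n * \<theta>)))"
    using nn P by (intro sum_le_suminf) (auto simp: sums_iff)
  finally show "c 1 / 20 * \<theta>\<^sup>2 \<le> P" using P by (simp add: sums_iff)
qed

text \<open>The termwise cubic remainder of the sine is summed with nonnegative weights, so the
  linear part of the series is governed by the first moment.\<close>

lemma sin_series_bound:
  fixes c :: "nat \<Rightarrow> real"
  assumes c: "\<And>n. n > 0 \<Longrightarrow> c n \<ge> 0"
    and s1: "(\<lambda>n. real n * c n) sums A"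
    and s3: "(\<lambda>n. real n ^ 3 * c n) sums B"
    and Q: "(\<lambda>n. c n * sin (real n * \<theta>)) sums Q"
  shows "\<bar>Q - A * \<theta>\<bar> \<le> B / 6 * \<bar>\<theta>\<bar> ^ 3"
proof -
  have d: "(\<lambda>n. c n * sin (real n * \<theta>) - real n * c n * \<theta>) sums (Q - A * \<theta>)"
    by (intro sums_diff sums_mult2 Q s1)
  have e: "(\<lambda>n. real n ^ 3 * c n * (\<bar>\<theta>\<bar> ^ 3 / 6)) sums (B * (\<bar>\<theta>\<bar> ^ 3 / 6))"
    by (intro sums_mult2 s3)
  have "norm (c n * sin (real n * \<theta>) - real n * c n * \<theta>) \<le> real n ^ 3 * c n * (\<bar>\<theta>\<bar> ^ 3 / 6)" for n
  proof (cases "n = 0")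
    case False
    have "c n * sin (real n * \<theta>) - real n * c n * \<theta> = c n * (sin (real n * \<theta>) - real n * \<theta>)"
      by (simp add: algebra_simps)
    also have "norm \<dots> \<le> c n * (\<bar>real n * \<theta>\<bar> ^ 3 / 6)"
      using mult_left_mono[OF sin_minus_self_bound, of "c n" "real n * \<theta>"] c[of n] False by (simp add: abs_mult)
    finally show ?thesis by (simp add: power_mult_distrib abs_mult mult_ac)
  qed auto
  then have "norm (suminf (\<lambda>n. c n * sin (real n * \<theta>) - real n * c n * \<theta>))
      \<le> suminf (\<lambda>n. real n ^ 3 * c n * (\<bar>\<theta>\<bar> ^ 3 / 6))"
    by (intro norm_suminf_le) (use e in \<open>auto simp: sums_iff\<close>)
  then show ?thesis using d e by (simp add: sums_iff)
qed

section \<open>The saddle point\<close>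

text \<open>On \<open>t \<ge> 1\<close> the left side equals
  \<open>t powr (1 - \<sigma>) - t powr (- \<sigma>)\<close>, which increases strictly from 0
  without bound.\<close>

lemma ex1_saddle:
  assumes "0 < \<sigma>" "\<sigma> < 1" "u > 0"
  shows "\<exists>!t. is_saddle \<sigma> u t"
proof -
  define h where "h t = t powr (1 - \<sigma>) - t powr (- \<sigma>)" for t :: real
  have h: "t powr (- \<sigma>) * (t - 1) = h t" if "t > 1" for t
    using that by (simp add: h_def algebra_simps powr_diff powr_minus divide_simps)
  have mono: "h s < h t" if "1 \<le> s" "s < t" for s t
  proof -
    have "s powr (1 - \<sigma>) < t powr (1 - \<sigma>)" using that assms by (intro powr_less_mono2) auto
    moreover have "t powr (- \<sigma>) < s powr (- \<sigma>)" using that assms by (intro powr_less_mono2_neg) auto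
    ultimately show ?thesis by (simp add: h_def)
  qed
  define y where "y = 1 / (\<sigma> * u)"
  have y: "y > 0" using assms by (simp add: y_def)
  \<comment> \<open>Chosen so that \<open>T powr (1 - \<sigma>) = 1 + y\<close>; the subtracted
    power is at most 1, hence \<open>h T \<ge> y\<close>.\<close>
  define T where "T = (1 + y) powr (1 / (1 - \<sigma>))"
  have T: "T > 1" using y assms unfolding T_def by (intro gr_one_powr) auto
  have "T powr (1 - \<sigma>) = 1 + y" using y assms by (simp add: T_def powr_powr)
  moreover have "T powr (- \<sigma>) \<le> 1" using T assms by (simp add: powr_minus ge_one_powr_ge_zero inverse_le_1_iff)
  ultimately have "y \<le> h T" by (simp add: h_def)
  moreover have "h 1 = 0" by (simp add: h_def)
  moreover have "continuous_on {1..T} h" unfolding h_def by (intro continuous_intros) auto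
  ultimately obtain t where t: "1 \<le> t" "h t = y"
    using IVT'[of h 1 y T] y T by auto
  then have "t \<noteq> 1" using y \<open>h 1 = 0\<close> by auto
  with t have "is_saddle \<sigma> u t" by (simp add: is_saddle_def h y_def)
  moreover have "s = t" if "is_saddle \<sigma> u s" "is_saddle \<sigma> u t" for s t
    using that mono[of s t] mono[of t s] by (cases s t rule: linorder_cases) (auto simp: is_saddle_def h)
  ultimately show ?thesis by blast
qed

section \<open>The integral on the saddle circle\<close>

lemma pochhammer_minus_nonpos:
  fixes \<sigma> :: real
  assumes "0 < \<sigma>" "\<sigma> < 1" "n > 0"
  shows "pochhammer (- \<sigma>) n \<le> 0"
proof -
  obtain m where "n = Suc m" using assms by (cases n) auto
  \<comment> \<open>For \<open>0 < \<sigma> < 1\<close> only the leading factor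
    \<open>- \<sigma>\<close> is negative.\<close>
  moreover have "pochhammer (1 - \<sigma>) m > 0" using assms by (intro pochhammer_pos) auto
  ultimately show ?thesis using assms by (simp add: pochhammer_rec mult_le_0_iff)
qed

text \<open>\<open>Psi11\<close> is real, so the real part of the integrand suffices. The modulus at
  \<open>\<theta> = 0\<close> is pulled out so that the remaining exponent vanishes there.\<close>

lemma Psi11_conv_real_integral:
  fixes r \<sigma> u :: real
  assumes r: "0 < r" "r < 1" and "0 \<le> \<sigma>"
  defines "S \<equiv> \<lambda>\<theta>. (1 - rcis r \<theta>) powr (of_real \<sigma>)"
  shows "Psi11 (- \<sigma>) k (- (real k * u)) = fact k / (2 * pi * r ^ k) * exp (- real k * u * (1 - r) powr \<sigma>) *
    integral {-pi..pi} (\<lambda>\<theta>. exp (real k * (- u * (Re (S \<theta>) - (1 - r) powr \<sigma>))) *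
      cos (real k * (- u * Im (S \<theta>) - \<theta>)))"
proof -
  let ?f = "\<lambda>\<theta>. exp (- of_real (real k * u) * S \<theta>) * cis (- (real k * \<theta>))"
  let ?g = "\<lambda>\<theta>. exp (real k * (- u * (Re (S \<theta>) - (1 - r) powr \<sigma>))) *
      cos (real k * (- u * Im (S \<theta>) - \<theta>))"
  have "?f integrable_on {-pi..pi}"
    using continuous_on_one_minus_rcis_powr[OF r, of "{-pi..pi}" \<sigma>, folded S_def]
    by (intro integrable_continuous_real continuous_intros)
  then have "((\<lambda>\<theta>. Re (?f \<theta>)) has_integral Re (integral {-pi..pi} ?f)) {-pi..pi}"
    by (intro has_integral_Re integrable_integral)
  moreover have "Re (?f \<theta>) = exp (- real k * u * (1 - r) powr \<sigma>) * ?g \<theta>" for \<theta>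
  proof -
    have "?f \<theta> = exp (Complex (- real k * u * Re (S \<theta>)) (real k * (- u * Im (S \<theta>) - \<theta>)))"
      unfolding cis_conv_exp exp_add[symmetric]
      by (rule arg_cong[where f = exp]) (simp add: complex_eq_iff algebra_simps)
    then have "Re (?f \<theta>) = exp (- real k * u * Re (S \<theta>)) * cos (real k * (- u * Im (S \<theta>) - \<theta>))"
      by (simp add: Re_exp)
    also have "exp (- real k * u * Re (S \<theta>)) = exp (- real k * u * (1 - r) powr \<sigma>)
        * exp (real k * (- u * (Re (S \<theta>) - (1 - r) powr \<sigma>)))"
      by (simp add: algebra_simps flip: exp_add)
    finally show ?thesis by (simp only: mult.assoc)
  qed
  ultimately have "((\<lambda>\<theta>. exp (- real k * u * (1 - r) powr \<sigma>) * ?g \<theta>) has_integral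
      Re (integral {-pi..pi} ?f)) {-pi..pi}"
    by (simp only:)
  from integral_unique[OF this]
  have I: "Re (integral {-pi..pi} ?f) = exp (- real k * u * (1 - r) powr \<sigma>) * integral {-pi..pi} ?g"
    unfolding integral_mult_right ..
  have Re_mult: "Re (of_real a * z) = a * Re z" for a z by simp
  have "Psi11 (- \<sigma>) k (- (real k * u)) = Re (of_real (Psi11 (- \<sigma>) k (- (real k * u))))" by simp
  also have "\<dots> = fact k / (2 * pi * r ^ k) * Re (integral {-pi..pi} ?f)"
    unfolding S_def by (subst Psi11_conv_integral[OF assms(1-3)]) (rule Re_mult)
  finally show ?thesis unfolding I by simp
qed

text \<open>With the weights \<open>c n\<close>, the real exponent is minus a cosine series and the
  phase is a sine series minus \<open>\<theta>\<close>. The saddle equation says that the first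
  moment is 1, so the linear phase cancels; \<open>A\<close> is the second moment. The fourth and
  third moments supply the error constants of the Laplace estimate.\<close>

lemma circle_integral_asymptotic:
  fixes r \<sigma> u :: real
  assumes r: "0 < r" "r < 1" and \<sigma>: "0 < \<sigma>" "\<sigma> < 1" and u: "u > 0"
    and saddle: "u * \<sigma> * r * (1 - r) powr (\<sigma> - 1) = 1"
  defines "S \<equiv> \<lambda>\<theta>. (1 - rcis r \<theta>) powr (of_real \<sigma>)"
  defines "A \<equiv> 1 + (1 - \<sigma>) * r / (1 - r)"
  shows "\<exists>M. \<forall>k>0. \<bar>integral {-pi..pi} (\<lambda>\<theta>. exp (k * (- u * (Re (S \<theta>) - (1 - r) powr \<sigma>))) *
      cos (k * (- u * Im (S \<theta>) - \<theta>))) - sqrt (2 * pi / (k * A))\<bar> \<le> M / (k * sqrt k)"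
proof -
  define p where "p n = pochhammer (- \<sigma>) n / fact n * r ^ n" for n
  define c where "c n = - u * p n" for n
  have c: "c n \<ge> 0" if "n > 0" for n
    using pochhammer_minus_nonpos[OF \<sigma> that] r u
    by (simp add: c_def p_def mult_le_0_iff divide_le_0_iff zero_le_mult_iff)
  have c1: "c 1 = u * \<sigma> * r" by (simp add: c_def p_def)
  have "summable (\<lambda>n. real n ^ m * p n)" for m
  proof -
    \<comment> \<open>The radius \<open>(1 + r) / 2\<close> lies strictly between \<open>r\<close>
      and 1, leaving room for the polynomial weight.\<close>
    have "summable (\<lambda>n. real n ^ m * (\<bar>pochhammer (- \<sigma>) n / fact n\<bar> * r ^ n))"
      by (rule summable_power_times_powser[of _ "(1 + r) / 2", OF pochhammer_powser_summable]) (use r in auto)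
    moreover have "norm (real n ^ m * (\<bar>pochhammer (- \<sigma>) n / fact n\<bar> * r ^ n)) = norm (real n ^ m * p n)" for n
      using r by (simp add: p_def abs_mult)
    ultimately show ?thesis
      using r by (intro summable_norm_cancel[of "\<lambda>n. real n ^ m * p n"]) (simp add: abs_mult)
  qed
  from summable_mult[OF this, of "- u"]
  have "summable (\<lambda>n. real n ^ m * c n)" for m by (simp add: c_def mult_ac)
  then have s: "(\<lambda>n. real n ^ m * c n) sums (\<Sum>n. real n ^ m * c n)" for m
    by (rule summable_sums)
  have s1: "(\<lambda>n. real n * c n) sums 1"
    using sums_mult[OF pochhammer_powser_moment1[of r "- \<sigma>"], of "- u"] r saddle
    by (simp add: c_def p_def mult_ac)
  have s2: "(\<lambda>n. (real n)\<^sup>2 * c n) sums A"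
  proof -
    \<comment> \<open>Lowering the exponent by one expresses the higher power in the second moment
      through the saddle equation.\<close>
    have "(1 - r) powr (\<sigma> - 1) = (1 - r) * (1 - r) powr (\<sigma> - 2)"
      using r powr_add[of "1 - r" 1 "\<sigma> - 2"] by simp
    then have *: "u * \<sigma> * r * (1 - r) powr (\<sigma> - 2) = 1 / (1 - r)"
      using saddle r by (simp add: eq_divide_eq mult_ac)
    have "(\<lambda>n. - u * ((real n)\<^sup>2 * p n)) sums
        (- u * (- \<sigma> * r * ((- \<sigma> + 1) * r * (1 - r) powr (- (- \<sigma> + 2)) + (1 - r) powr (- (- \<sigma> + 1)))))"
      unfolding p_def using r by (intro sums_mult pochhammer_powser_moment2) auto
    also have "- u * (- \<sigma> * r * ((- \<sigma> + 1) * r * (1 - r) powr (- (- \<sigma> + 2)) + (1 - r) powr (- (- \<sigma> + 1))))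
       = (1 - \<sigma>) * r * (u * \<sigma> * r * (1 - r) powr (\<sigma> - 2)) + u * \<sigma> * r * (1 - r) powr (\<sigma> - 1)"
      by (simp add: algebra_simps)
    also have "\<dots> = A" unfolding * saddle by (simp add: A_def)
    finally show ?thesis by (simp add: c_def mult_ac)
  qed
  have ser: "(\<lambda>n. of_real (c n) * (1 - cis (real n * \<theta>))) sums (of_real u * (S \<theta> - of_real ((1 - r) powr \<sigma>)))" for \<theta>
  proof -
    have "(\<lambda>n. pochhammer (- of_real \<sigma>) n / fact n * rcis r \<theta> ^ n) sums S \<theta>"
      unfolding S_def using r by (intro one_minus_powr_sums) auto
    moreover have "pochhammer (- of_real \<sigma>) n / fact n * rcis r \<theta> ^ n = complex_of_real (p n) * cis (real n * \<theta>)" for n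
      using pochhammer_of_real[of "- \<sigma>" n, where 'a = complex]
      unfolding rcis_def power_mult_distrib Complex.DeMoivre by (simp add: p_def)
    ultimately have 1: "(\<lambda>n. complex_of_real (p n) * cis (real n * \<theta>)) sums S \<theta>" by simp
    have "p sums ((1 - r) powr \<sigma>)"
      using pochhammer_powser_sums[of r "- \<sigma>"] r by (simp add: p_def[abs_def])
    then have 2: "(\<lambda>n. complex_of_real (p n)) sums of_real ((1 - r) powr \<sigma>)" by (rule sums_of_real)
    from sums_mult[OF sums_diff[OF 1 2], of "of_real u"] show ?thesis
      by (simp add: c_def algebra_simps)
  qed
  have Re: "(\<lambda>n. c n * (1 - cos (real n * \<theta>))) sums (u * (Re (S \<theta>) - (1 - r) powr \<sigma>))" for \<theta>
    using sums_Re[OF ser[of \<theta>]] by simp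
  have Im: "(\<lambda>n. c n * sin (real n * \<theta>)) sums (- u * Im (S \<theta>))" for \<theta>
    using sums_minus[OF sums_Im[OF ser[of \<theta>]]] by simp
  have S_cont: "continuous_on {-pi..pi} S"
    unfolding S_def using r by (rule continuous_on_one_minus_rcis_powr)
  show ?thesis
  proof (rule laplace_asymptotic_real_part)
    have "c 1 > 0" unfolding c1 using r \<sigma> u by simp
    then show "pi > 0" "A > 0" "c 1 / 20 > 0"
      using r \<sigma> by (auto simp: A_def intro!: add_pos_nonneg)
    show "continuous_on {-pi..pi} (\<lambda>\<theta>. - u * (Re (S \<theta>) - (1 - r) powr \<sigma>))"
      and "continuous_on {-pi..pi} (\<lambda>\<theta>. - u * Im (S \<theta>) - \<theta>)"
      by (intro continuous_intros S_cont)+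
    fix \<theta> :: real assume \<theta>: "\<bar>\<theta>\<bar> \<le> pi"
    have "\<bar>u * (Re (S \<theta>) - (1 - r) powr \<sigma>) - A / 2 * \<theta>\<^sup>2\<bar> \<le> (\<Sum>n. real n ^ 4 * c n) / 24 * \<theta> ^ 4"
      by (rule cos_series_bounds(1)[OF c s2 s Re])
    then show "\<bar>- u * (Re (S \<theta>) - (1 - r) powr \<sigma>) + A / 2 * \<theta>\<^sup>2\<bar> \<le> (\<Sum>n. real n ^ 4 * c n) / 24 * \<theta> ^ 4"
      by linarith
    show "- u * (Re (S \<theta>) - (1 - r) powr \<sigma>) \<le> - (c 1 / 20) * \<theta>\<^sup>2"
      using cos_series_bounds(2)[OF c s2 s Re \<theta>] by simp
    show "\<bar>- u * Im (S \<theta>) - \<theta>\<bar> \<le> (\<Sum>n. real n ^ 3 * c n) / 6 * \<bar>\<theta>\<bar> ^ 3"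
      using sin_series_bound[OF c s1 s Im] by simp
  qed
qed

section \<open>Assembly of the asymptotic formula\<close>

theorem mainTheorem7:
  fixes \<sigma> u :: real
  assumes "0 < \<sigma>" and "\<sigma> < 1" and "u > 0"
  shows "(\<exists>!t. is_saddle \<sigma> u t) \<and>
    (\<exists>\<epsilon> :: nat \<Rightarrow> real. \<epsilon> \<in> O(\<lambda>k. 1 / real k) \<and>
      (\<forall>k\<ge>1. Psi11 (-\<sigma>) k (- (real k * u)) =
         Gamma (real k) * sqrt (real k / (2 * pi * (1 - \<sigma>))) *
         (t_saddle \<sigma> u + \<sigma> / (1 - \<sigma>)) powr (- 1 / 2) *
         exp (real k * psi_saddle \<sigma> (t_saddle \<sigma> u)) * (1 + \<epsilon> k)))"
proof (rule conjI)
  show ex1: "\<exists>!t. is_saddle \<sigma> u t" using assms by (rule ex1_saddle)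
  define t where "t = t_saddle \<sigma> u"
  have "is_saddle \<sigma> u t" unfolding t_def t_saddle_def by (rule theI'[OF ex1])
  then have t: "t > 1" "t powr (- \<sigma>) * (t - 1) = 1 / (\<sigma> * u)" by (auto simp: is_saddle_def)
  \<comment> \<open>In terms of \<open>r\<close> the equation for \<open>t\<close> becomes the
    condition that the first moment is 1.\<close>
  define r where "r = 1 - 1 / t"
  have r: "0 < r" "r < 1" "1 - r = 1 / t" using t by (auto simp: r_def)
  have rt: "r * t = t - 1" using t by (simp add: r_def field_simps)
  have pw: "(1 - r) powr \<sigma> = t powr (- \<sigma>)"
    using t unfolding r(3) by (simp add: powr_divide powr_minus_divide)
  have pw1: "(1 - r) powr (\<sigma> - 1) = t * t powr (- \<sigma>)"
    using t powr_add[of "1 - r" \<sigma> "-1"] by (simp add: pw) (simp add: r(3) powr_minus)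
  have saddle: "u * \<sigma> * r * (1 - r) powr (\<sigma> - 1) = 1"
  proof -
    have "u * \<sigma> * r * (1 - r) powr (\<sigma> - 1) = u * \<sigma> * (t powr (- \<sigma>) * (r * t))"
      unfolding pw1 by (simp add: mult_ac)
    then show ?thesis unfolding rt t(2) using assms by simp
  qed
  define A where "A = 1 + (1 - \<sigma>) * r / (1 - r)"
  have A: "A = (1 - \<sigma>) * (t + \<sigma> / (1 - \<sigma>))"
  proof -
    have "r / (1 - r) = t - 1" using t r rt by (simp add: field_simps)
    then have "A = 1 + (1 - \<sigma>) * (t - 1)"
      by (simp add: A_def flip: times_divide_eq_right)
    also have "\<dots> = (1 - \<sigma>) * t + \<sigma>" by (simp add: algebra_simps)
    finally have "A = (1 - \<sigma>) * t + \<sigma>" .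
    moreover have "(1 - \<sigma>) * (\<sigma> / (1 - \<sigma>)) = \<sigma>" using assms by simp
    ultimately show ?thesis by (simp only: distrib_left)
  qed
  have Tpos: "t + \<sigma> / (1 - \<sigma>) > 0" using t assms by (intro add_pos_pos) auto
  then have Apos: "A > 0" using assms by (simp add: A)
  \<comment> \<open>The exponential factor is the modulus at \<open>\<theta> = 0\<close> divided by
    \<open>r ^ k\<close>; the saddle equation eliminates \<open>u\<close> through
    \<open>u * t powr (- \<sigma>) = 1 / (\<sigma> * (t - 1))\<close>.\<close>
  have psi: "exp (real k * psi_saddle \<sigma> t) = exp (- real k * u * (1 - r) powr \<sigma>) / r ^ k" for k
  proof -
    have "u * (1 - r) powr \<sigma> = 1 / (\<sigma> * (t - 1))"
      unfolding pw using t assms by (simp add: field_simps)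
    also have "t - 1 = r / (1 / t)" using rt by simp
    finally have "u * (1 - r) powr \<sigma> = 1 / t / (\<sigma> * r)" by simp
    then have psi_eq: "psi_saddle \<sigma> t = - ln r - u * (1 - r) powr \<sigma>"
      by (simp add: psi_saddle_def Let_def r_def)
    have "real k * psi_saddle \<sigma> t = - real k * u * (1 - r) powr \<sigma> - real k * ln r"
      unfolding psi_eq by (simp add: algebra_simps)
    then show ?thesis using r by (simp add: exp_diff exp_of_nat_mult)
  qed
  define J where "J k = integral {-pi..pi} (\<lambda>\<theta>.
     exp (k * (- u * (Re ((1 - rcis r \<theta>) powr (of_real \<sigma>)) - (1 - r) powr \<sigma>))) *
      cos (k * (- u * Im ((1 - rcis r \<theta>) powr (of_real \<sigma>)) - \<theta>)))" for k
  obtain M where M: "\<And>k. k > 0 \<Longrightarrow> \<bar>J k - sqrt (2 * pi / (k * A))\<bar> \<le> M / (k * sqrt k)"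
    using circle_integral_asymptotic[OF r(1,2) assms saddle] unfolding J_def A_def by blast
  \<comment> \<open>The exact relative error of the circle integral. Dividing the absolute error by
    the main term cancels \<open>1 / sqrt k\<close> and leaves order \<open>1 / k\<close>.\<close>
  define \<epsilon> where "\<epsilon> k = J (real k) / sqrt (2 * pi / (real k * A)) - 1" for k
  have "\<epsilon> \<in> O(\<lambda>k. 1 / real k)"
  proof (rule bigoI, rule eventually_mono[OF eventually_gt_at_top[of 0]])
    fix k :: nat assume k: "k > 0"
    have "\<epsilon> k = (J (real k) - sqrt (2 * pi / (real k * A))) / sqrt (2 * pi / (real k * A))"
      using k Apos by (simp add: \<epsilon>_def diff_divide_distrib)
    then have "norm (\<epsilon> k) = \<bar>J (real k) - sqrt (2 * pi / (real k * A))\<bar> / sqrt (2 * pi / (real k * A))"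
      using k Apos by simp
    also have "\<dots> \<le> M / (real k * sqrt (real k)) / sqrt (2 * pi / (real k * A))"
      using M[of "real k"] k Apos by (intro divide_right_mono) auto
    also have "\<dots> = M / sqrt (2 * pi / A) * norm (1 / real k)"
      using k Apos by (simp add: real_sqrt_divide real_sqrt_mult)
    finally show "norm (\<epsilon> k) \<le> M / sqrt (2 * pi / A) * norm (1 / real k)" .
  qed
  moreover have "Psi11 (-\<sigma>) k (- (real k * u)) =
         Gamma (real k) * sqrt (real k / (2 * pi * (1 - \<sigma>))) *
         (t_saddle \<sigma> u + \<sigma> / (1 - \<sigma>)) powr (- 1 / 2) *
         exp (real k * psi_saddle \<sigma> (t_saddle \<sigma> u)) * (1 + \<epsilon> k)" if k: "k \<ge> 1" for k
  proof -
    \<comment> \<open>The extra factor \<open>k\<close> joins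
      \<open>sqrt (2 * pi / (k * A)) / (2 * pi)\<close> to give
      \<open>sqrt (k / (2 * pi * A))\<close>.\<close>
    have fact: "fact k = real k * Gamma (real k)"
      using k Gamma_fact[of "k - 1", where 'a = real] by (simp add: of_nat_diff fact_reduce)
    have "sqrt (real k / (2 * pi * (1 - \<sigma>))) * (t + \<sigma> / (1 - \<sigma>)) powr (- 1 / 2) = sqrt (real k / (2 * pi * A))"
      using Tpos unfolding A
      by (simp add: powr_minus_divide powr_half_sqrt real_sqrt_divide real_sqrt_mult)
    also have "\<dots> = real k / (2 * pi) * sqrt (2 * pi / (real k * A))"
    proof -
      have "real k / (2 * pi * A) = (real k / (2 * pi))\<^sup>2 * (2 * pi / (real k * A))"
        using k Apos by (simp add: power2_eq_square field_simps)
      then show ?thesis by (simp only: real_sqrt_mult real_sqrt_abs) simp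
    qed
    finally have pre: "sqrt (real k / (2 * pi * (1 - \<sigma>))) * (t + \<sigma> / (1 - \<sigma>)) powr (- 1 / 2)
      = real k / (2 * pi) * sqrt (2 * pi / (real k * A))" .
    have "J (real k) = sqrt (2 * pi / (real k * A)) * (1 + \<epsilon> k)"
      using k Apos by (simp add: \<epsilon>_def)
    moreover have "Psi11 (-\<sigma>) k (- (real k * u)) = fact k / (2 * pi * r ^ k) *
        exp (- real k * u * (1 - r) powr \<sigma>) * J (real k)"
      unfolding J_def using r assms by (intro Psi11_conv_real_integral) auto
    ultimately have "Psi11 (-\<sigma>) k (- (real k * u)) = Gamma (real k) *
       (real k / (2 * pi) * sqrt (2 * pi / (real k * A))) * exp (real k * psi_saddle \<sigma> t) * (1 + \<epsilon> k)"
      unfolding fact psi by simp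
    then show ?thesis unfolding pre[symmetric] t_def by (simp only: mult.assoc)
  qed
  ultimately show "\<exists>\<epsilon> :: nat \<Rightarrow> real. \<epsilon> \<in> O(\<lambda>k. 1 / real k) \<and>
      (\<forall>k\<ge>1. Psi11 (-\<sigma>) k (- (real k * u)) =
         Gamma (real k) * sqrt (real k / (2 * pi * (1 - \<sigma>))) *
         (t_saddle \<sigma> u + \<sigma> / (1 - \<sigma>)) powr (- 1 / 2) *
         exp (real k * psi_saddle \<sigma> (t_saddle \<sigma> u)) * (1 + \<epsilon> k))"
    by blast
qed

end
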